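(* Let $G$ be a graph of order $n$ and let $\mathcal{G}$ be an abelian group of order $4n$. If $n=2^{p}(2k+1)$ for some natural numbers $p$, $k$ (possibly zero), and there is a constant integer $c$ such that $\deg(v)\equiv c \pmod{2^{p+1}}$ for every $v\in V(G)$, then there exists a $\mathcal{G}$-distance magic labeling of the graph $G[C_4]$.
   Context: All graphs are simple and finite. The order of a graph is its number of vertices; $N_G(x)$ is the set of vertices adjacent to $x$ in $G$ and $\deg(x)=|N_G(x)|$. Natural numbers include $0$. $C_4$ is the cycle of length 4. For graphs $G$ and $H$, $G[H]$ denotes the graph obtained from $G$ by replacing every vertex $x$ of $G$ by an isomorphic copy $H^{x}$ of $H$ (keeping the edges inside each copy), where for distinct $x,y\in V(G)$ a vertex of $H^{x}$ is adjacent to a vertex of $H^{y}$ if and only if $xy$ is an edge of $G$ (the lexicographic product). Thus $G[C_4]$ has $4|V(G)|$ vertices. For a graph $\Gamma$ with $N$ vertices and an abelian group $\mathcal{G}$ of order $N$ (written additively), a $\mathcal{G}$-distance magic labeling of $\Gamma$ is an injection $f:V(\Gamma)\to\mathcal{G}$ (hence a bijection) such that there is an element $\mu\in\mathcal{G}$ with $w(x)=\sum_{y\in N_\Gamma(x)}f(y)=\mu$ for every $x\in V(\Gamma)$. *)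

theory Defs
  imports
    "Graph_Theory.Pair_Digraph"
    "HOL-Algebra.FiniteProduct"
    "HOL-Algebra.Coset"
    "HOL-Number_Theory.Cong"
begin

text \<open>
  Finite simple graphs are rendered by the locale \<^locale>\<open>pair_graph\<close>: a finite vertex set with a
  symmetric irreflexive adjacency relation on it, so an edge xy is the pair of arcs (x, y) and (y, x).
\<close>

definition neighborhood :: "'a pair_pre_digraph \<Rightarrow> 'a \<Rightarrow> 'a set" where
  "neighborhood G x = {y \<in> pverts G. (x, y) \<in> parcs G}"

definition vertex_degree :: "'a pair_pre_digraph \<Rightarrow> 'a \<Rightarrow> nat" where
  "vertex_degree G x = card (neighborhood G x)"

definition C4 :: "nat pair_pre_digraph" where
  "C4 = \<lparr> pverts = {0..<4},
          parcs = {(i, j). i < 4 \<and> j < 4 \<and> (j = (i + 1) mod 4 \<or> i = (j + 1) mod 4)} \<rparr>"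

text \<open>The lexicographic product G[H]; the copy of H replacing x consists of the pairs (x, h).\<close>

definition lex_product ::
    "'a pair_pre_digraph \<Rightarrow> 'b pair_pre_digraph \<Rightarrow> ('a \<times> 'b) pair_pre_digraph" where
  "lex_product G H =
    \<lparr> pverts = pverts G \<times> pverts H,
      parcs = {((x, h), (y, k)). x \<in> pverts G \<and> y \<in> pverts G \<and> h \<in> pverts H \<and> k \<in> pverts H \<and>
                 (x = y \<and> (h, k) \<in> parcs H \<or> x \<noteq> y \<and> (x, y) \<in> parcs G)} \<rparr>"

text \<open>
  The abelian group is a \<^locale>\<open>comm_group\<close>, whose notation is multiplicative: the sum of the
  labels over a neighborhood is \<^const>\<open>finprod\<close>.
\<close>

definition distance_magic_labeling ::
    "('b, 'm) monoid_scheme \<Rightarrow> 'a pair_pre_digraph \<Rightarrow> ('a \<Rightarrow> 'b) \<Rightarrow> bool" where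
  "distance_magic_labeling A \<Gamma> f \<longleftrightarrow>
     order A = card (pverts \<Gamma>) \<and>
     f ` pverts \<Gamma> \<subseteq> carrier A \<and> inj_on f (pverts \<Gamma>) \<and>
     (\<exists>\<mu>\<in>carrier A. \<forall>x\<in>pverts \<Gamma>. finprod A f (neighborhood \<Gamma> x) = \<mu>)"

lemma pair_graph_C4: "pair_graph C4"
proof -
  have "finite {(i::nat, j::nat). i < 4 \<and> j < 4 \<and> (j = (i + 1) mod 4 \<or> i = (j + 1) mod 4)}"
    by (rule finite_subset[of _ "{0..<4} \<times> {0..<4}"]) auto
  moreover have "Suc i mod 4 \<noteq> i" "i \<noteq> Suc i mod 4" for i :: nat
    by presburger+
  ultimately show ?thesis
    unfolding C4_def
    by unfold_locales (auto simp: symmetric_def sym_def)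
qed

lemma pair_graph_lex_product:
  assumes "pair_graph G" "pair_graph H"
  shows "pair_graph (lex_product G H)"
proof -
  interpret G: pair_graph G by fact
  interpret H: pair_graph H by fact
  have symG: "(y, x) \<in> parcs G" if "(x, y) \<in> parcs G" for x y
    using G.pair_sym_arcs that by (auto simp: symmetric_def sym_def)
  have symH: "(y, x) \<in> parcs H" if "(x, y) \<in> parcs H" for x y
    using H.pair_sym_arcs that by (auto simp: symmetric_def sym_def)
  have fin: "finite (pverts G \<times> pverts H)"
    using G.pair_finite_verts H.pair_finite_verts by simp
  have "parcs (lex_product G H) \<subseteq> (pverts G \<times> pverts H) \<times> (pverts G \<times> pverts H)"
    by (auto simp: lex_product_def)
  then have "finite (parcs (lex_product G H))"
    by (rule finite_subset) (use fin in auto)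
  moreover have "symmetric (lex_product G H)"
    by (auto simp: symmetric_def sym_def lex_product_def intro: symG symH)
  ultimately show ?thesis
    by unfold_locales (use fin in \<open>auto simp: lex_product_def dest: H.pair_no_loops\<close>)
qed

end

theory Submission
  imports Defs "HOL-Algebra.Multiplicative_Group"
begin

text \<open>
  Additively, suppose that some \<open>s\<close> in the group is not of the form \<open>2 x\<close>. Then \<open>x \<mapsto> s - x\<close> is
  an involution without fixed points, so the group splits into pairs of sum \<open>s\<close>
  (\<open>involution_transversal\<close>), and these pairs can be placed on the pairs of opposite vertices of
  the copies of the 4-cycle (\<open>labeling_with_constant_opposite_sums\<close>). The two neighbors of a vertex
  inside its own copy are opposite to each other and contribute \<open>s\<close>; each neighboring copy
  contributes its total \<open>2 s\<close>. So a vertex over \<open>v\<close> has weight \<open>s + deg v \<cdot> 2 s\<close>, which is constant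
  when the degrees agree modulo \<open>2\<^sup>p\<^sup>+\<^sup>1\<close> and \<open>2\<^sup>p\<^sup>+\<^sup>2 s = 0\<close>.

  An element \<open>s\<close> with both properties exists because \<open>4 n = 2\<^sup>p\<^sup>+\<^sup>2 (2 k + 1)\<close>
  (\<open>nonsquare_of_two_power_order\<close>): in a group of even order some
  element is not a double, and its multiple by the odd number \<open>2 k + 1\<close> is still not a double
  and has a power of two as its order.
\<close>

lemma involution_transversal:
  assumes "finite S"
    and "\<And>x. x \<in> S \<Longrightarrow> t x \<in> S" "\<And>x. x \<in> S \<Longrightarrow> t (t x) = x" "\<And>x. x \<in> S \<Longrightarrow> t x \<noteq> x"
  shows "\<exists>T. T \<inter> t ` T = {} \<and> T \<union> t ` T = S"
  using assms
proof (induction S rule: finite_psubset_induct)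
  case (psubset S)
  show ?case
  proof (cases "S = {}")
    case False
    then obtain a where a: "a \<in> S" by blast
    let ?R = "S - {a, t a}"
    have "t x \<in> ?R" if "x \<in> ?R" for x
      using that psubset.prems(1,2) a by (metis Diff_iff insert_iff singletonD)
    moreover have "?R \<subset> S" using a by blast
    moreover have "t (t x) = x" "t x \<noteq> x" if "x \<in> ?R" for x
      using that psubset.prems(2,3) by simp_all
    ultimately have "\<exists>T. T \<inter> t ` T = {} \<and> T \<union> t ` T = ?R"
      by (intro psubset.IH)
    then obtain T where T: "T \<inter> t ` T = {}" "T \<union> t ` T = ?R" by blast
    have "a \<notin> t ` T" "t a \<notin> T" "a \<notin> T" "t a \<notin> t ` T"
      using T(2) by blast+
    moreover have "t a \<noteq> a" "t a \<in> S" using psubset.prems a by auto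
    ultimately have "insert a T \<inter> t ` insert a T = {}" "insert a T \<union> t ` insert a T = S"
      using T a by auto
    then show ?thesis by blast
  qed auto
qed

lemma card_involution_transversal:
  assumes "finite S" "\<And>x. x \<in> S \<Longrightarrow> t (t x) = x" "T \<inter> t ` T = {}" "T \<union> t ` T = S"
  shows "inj_on t T" "card S = 2 * card T"
proof -
  show inj: "inj_on t T"
    using assms(2,4) by (intro inj_on_inverseI[where g = t]) blast
  have "finite T" using assms(1,4) finite_subset by blast
  then show "card S = 2 * card T"
    using assms(3,4) inj by (auto simp: card_Un_disjoint card_image)
qed

text \<open>
  If every element were a square, squaring would be injective by finiteness, so only \<open>\<one>\<close> would be
  its own inverse, and inversion would pair up the remaining elements, of which there is an odd
  number.
\<close>
lemma (in comm_group) nonsquare_of_even_order: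
  assumes "finite (carrier G)" "even (order G)"
  shows "\<exists>s\<in>carrier G. \<forall>x\<in>carrier G. x \<otimes> x \<noteq> s"
proof (rule ccontr)
  assume "\<not> ?thesis"
  then have "(\<lambda>x. x \<otimes> x) ` carrier G = carrier G" by (fastforce simp: image_iff)
  then have inj: "inj_on (\<lambda>x. x \<otimes> x) (carrier G)"
    using assms(1) by (intro eq_card_imp_inj_on) simp_all
  let ?S = "carrier G - {\<one>}"
  have inv_ne: "inv x \<noteq> x" if "x \<in> ?S" for x
  proof
    assume "inv x = x"
    then have "x \<otimes> x = \<one> \<otimes> \<one>" using that r_inv[of x] by simp
    then have "x = \<one>" using inj_onD[OF inj] that by blast
    then show False using that by simp
  qed
  have inv_closed': "inv x \<in> ?S" if "x \<in> ?S" for x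
    using that inv_eq_1_iff by simp
  have inv_inv': "inv (inv x) = x" if "x \<in> ?S" for x
    using that by simp
  have fin: "finite ?S" using assms(1) by simp
  obtain T where T: "T \<inter> m_inv G ` T = {}" "T \<union> m_inv G ` T = ?S"
    using involution_transversal[OF fin, of "m_inv G"] inv_ne inv_closed' inv_inv' by blast
  have "even (card ?S)"
    using card_involution_transversal(2)[OF fin _ T] inv_inv' by simp
  moreover have "order G = Suc (card ?S)"
    unfolding order_def using card.remove[OF assms(1) one_closed] .
  ultimately show False using assms(2) by simp
qed

text \<open>
  If \<open>r\<close> is not a square, then neither is \<open>s = r\<^sup>2\<^sup>k\<^sup>+\<^sup>1 = (r\<^sup>k)\<^sup>2 r\<close>, since \<open>r\<close> is the quotient of \<open>s\<close> by
  a square; and \<open>s\<close> raised to the power \<open>2\<^sup>m\<close> is \<open>r\<close> raised to the group order.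
\<close>
lemma (in comm_group) nonsquare_of_two_power_order:
  assumes "order G = 2 ^ m * (2 * k + 1)" "m > 0"
  shows "\<exists>s\<in>carrier G. s [^] (2 ^ m :: nat) = \<one> \<and> (\<forall>x\<in>carrier G. x \<otimes> x \<noteq> s)"
proof -
  have fin: "finite (carrier G)"
    using assms(1) order_gt_0_iff_finite by simp
  have "even (order G)" using assms by simp
  then obtain r where r: "r \<in> carrier G" "\<And>x. x \<in> carrier G \<Longrightarrow> x \<otimes> x \<noteq> r"
    using nonsquare_of_even_order[OF fin] by blast
  define s where "s = r [^] (2 * k + 1)"
  have "s [^] (2 ^ m :: nat) = r [^] order G"
    using r(1) by (simp only: s_def nat_pow_pow assms(1) mult.commute)
  then have "s [^] (2 ^ m :: nat) = \<one>" using pow_order_eq_1 r(1) by simp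
  moreover have "x \<otimes> x \<noteq> s" if x: "x \<in> carrier G" for x
  proof
    assume "x \<otimes> x = s"
    let ?y = "r [^] k"
    have y: "?y \<in> carrier G" using r(1) by simp
    have "s = (?y \<otimes> ?y) \<otimes> r"
      using r(1) by (simp add: s_def nat_pow_mult mult_2)
    then have "r = inv (?y \<otimes> ?y) \<otimes> (x \<otimes> x)"
      using \<open>x \<otimes> x = s\<close> y r(1) inv_solve_left by simp
    also have "\<dots> = (x \<otimes> inv ?y) \<otimes> (x \<otimes> inv ?y)"
      using x y by (simp add: inv_mult m_ac)
    finally show False using r(2) x y by (metis inv_closed m_closed)
  qed
  moreover have "s \<in> carrier G" using r(1) by (simp add: s_def)
  ultimately show ?thesis by blast
qed

text \<open>
  The map \<open>x \<mapsto> s x\<^sup>-\<^sup>1\<close> has no fixed point precisely because \<open>s\<close> is not a square. A transversal of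
  its orbits labels the positions 0 and 1 of every copy, and the partners of these labels go to the
  opposite positions 2 and 3.
\<close>
lemma (in comm_group) labeling_with_constant_opposite_sums:
  assumes s: "s \<in> carrier G" "\<And>x. x \<in> carrier G \<Longrightarrow> x \<otimes> x \<noteq> s"
    and V: "finite V" and ord: "order G = 4 * card V" and fin: "finite (carrier G)"
  shows "\<exists>f. bij_betw f (V \<times> {0..<4::nat}) (carrier G) \<and>
             (\<forall>x\<in>V. f (x, 0) \<otimes> f (x, 2) = s \<and> f (x, 1) \<otimes> f (x, 3) = s)"
proof -
  define t where "t x = s \<otimes> inv x" for x
  have t: "t x \<in> carrier G" "t (t x) = x" "t x \<noteq> x" "x \<otimes> t x = s" if x: "x \<in> carrier G" for x
  proof -
    show "t x \<in> carrier G" using s(1) x by (simp add: t_def)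
    show eq: "x \<otimes> t x = s" using s(1) x by (simp add: t_def m_lcomm)
    show "t (t x) = x" using s(1) x by (simp add: t_def inv_mult m_assoc[symmetric])
    show "t x \<noteq> x" using eq s(2) x by metis
  qed
  obtain T where T: "T \<inter> t ` T = {}" "T \<union> t ` T = carrier G"
    using involution_transversal[OF fin, of t] t by blast
  have inj_t: "inj_on t T" and "card (carrier G) = 2 * card T"
    using card_involution_transversal[OF fin t(2) T] by auto
  then have "card (V \<times> {0..<2::nat}) = card T"
    using ord by (simp add: order_def card_cartesian_product)
  moreover have "finite (V \<times> {0..<2::nat})" using V by simp
  moreover have "finite T" using T(2) fin by (metis finite_Un)
  ultimately have "\<exists>g. bij_betw g (V \<times> {0..<2::nat}) T"
    by (intro finite_same_card_bij)
  then obtain g where g: "bij_betw g (V \<times> {0..<2::nat}) T" by blast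
  have g_mem: "g (x, i) \<in> T" if "x \<in> V" "i < 2" for x i
    using g that by (auto simp: bij_betw_def)
  define f where "f z = (if snd z < 2 then g z else t (g (fst z, snd z - 2)))" for z
  have "bij_betw f (V \<times> {0..<2}) T"
    using g by (rule bij_betw_cong[THEN iffD1, rotated]) (auto simp: f_def)
  moreover have "bij_betw f (V \<times> {2..<4}) (t ` T)"
  proof -
    have "bij_betw (\<lambda>z. (fst z, snd z - 2)) (V \<times> {2..<4::nat}) (V \<times> {0..<2})"
      by (rule bij_betw_byWitness[where f' = "\<lambda>z. (fst z, snd z + 2)"]) auto
    from bij_betw_trans[OF bij_betw_trans[OF this g] inj_on_imp_bij_betw[OF inj_t]]
    show ?thesis
      by (rule bij_betw_cong[THEN iffD1, rotated]) (auto simp: f_def)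
  qed
  ultimately have "bij_betw f (V \<times> {0..<2} \<union> V \<times> {2..<4}) (T \<union> t ` T)"
    using T(1) by (rule bij_betw_combine)
  moreover have "V \<times> {0..<2} \<union> V \<times> {2..<4} = V \<times> {0..<4::nat}" by auto
  ultimately have "bij_betw f (V \<times> {0..<4}) (carrier G)" using T(2) by simp
  moreover have "f (x, 0) \<otimes> f (x, 2) = s \<and> f (x, 1) \<otimes> f (x, 3) = s" if "x \<in> V" for x
  proof -
    have "g (x, 0) \<in> carrier G" "g (x, 1) \<in> carrier G"
      using g_mem[OF that] T(2) by auto
    then show ?thesis using t(4) by (simp add: f_def)
  qed
  ultimately show ?thesis by blast
qed

lemma (in comm_group) finprod_copies_of_C4:
  assumes "finite N" "\<And>x i. x \<in> N \<Longrightarrow> i < 4 \<Longrightarrow> f (x, i) \<in> carrier G"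
    and "\<And>x. x \<in> N \<Longrightarrow> f (x, 0) \<otimes> f (x, 2) = s" "\<And>x. x \<in> N \<Longrightarrow> f (x, 1) \<otimes> f (x, 3) = s"
    and s: "s \<in> carrier G"
  shows "finprod G f (N \<times> {0..<4::nat}) = s [^] (2 * card N)"
  using assms(1-4)
proof (induction N rule: finite_induct)
  case (insert y N)
  have copy: "{y} \<times> {0..<4::nat} = {(y, 0), (y, 2), (y, 1), (y, 3)}" by auto
  have mem: "f (y, i) \<in> carrier G" if "i < 4" for i using insert.prems(1) that by blast
  have "finprod G f ({y} \<times> {0..<4}) = (f (y, 0) \<otimes> f (y, 2)) \<otimes> (f (y, 1) \<otimes> f (y, 3))"
    unfolding copy using mem by (simp add: m_assoc)
  also have "\<dots> = s \<otimes> s" using insert.prems(2,3) by simp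
  finally have y: "finprod G f ({y} \<times> {0..<4}) = s \<otimes> s" .
  have "insert y N \<times> {0..<4::nat} = {y} \<times> {0..<4} \<union> N \<times> {0..<4}" by auto
  moreover have "finprod G f ({y} \<times> {0..<4} \<union> N \<times> {0..<4})
      = finprod G f ({y} \<times> {0..<4}) \<otimes> finprod G f (N \<times> {0..<4})"
    using insert.hyps insert.prems(1) by (intro finprod_Un_disjoint) auto
  moreover have "finprod G f (N \<times> {0..<4}) = s [^] (2 * card N)"
    using insert.IH insert.prems by blast
  ultimately show ?case
    using insert.hyps s y by (simp add: m_ac)
qed simp

lemma neighborhood_lex_product_C4:
  assumes "pair_graph G" "x \<in> pverts G" "i < 4"
  shows "neighborhood (lex_product G C4) (x, i)
    = {(x, (i + 1) mod 4), (x, (i + 3) mod 4)} \<union> neighborhood G x \<times> {0..<4}"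
proof -
  interpret pair_graph G by fact
  have "i = (j + 1) mod 4 \<longleftrightarrow> j = (i + 3) mod 4" if "j < 4" for j
  proof -
    have "i = 0 \<or> i = 1 \<or> i = 2 \<or> i = 3" "j = 0 \<or> j = 1 \<or> j = 2 \<or> j = 3"
      using assms(3) that by auto
    then show ?thesis by (elim disjE) simp_all
  qed
  moreover have "m mod 4 < 4" for m :: nat by simp
  ultimately have C4: "(i, j) \<in> parcs C4 \<longleftrightarrow> j = (i + 1) mod 4 \<or> j = (i + 3) mod 4" for j
    unfolding C4_def using assms(3)
    by (simp only: pair_pre_digraph.simps mem_Collect_eq prod.case) blast
  have C4_verts: "pverts C4 = {0..<4}" by (simp add: C4_def)
  have "j < 4" if "(i, j) \<in> parcs C4" for j
    using that by (simp add: C4_def)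
  moreover have "y \<noteq> x" if "(x, y) \<in> parcs G" for y
    using pair_no_loops[OF that] by auto
  ultimately have "neighborhood (lex_product G C4) (x, i)
      = {x} \<times> {j. (i, j) \<in> parcs C4} \<union> neighborhood G x \<times> pverts C4"
    using assms(2,3) by (auto simp: neighborhood_def lex_product_def C4_verts)
  moreover have "{j. (i, j) \<in> parcs C4} = {(i + 1) mod 4, (i + 3) mod 4}"
    using C4 by blast
  ultimately show ?thesis by (auto simp: C4_verts)
qed

lemma (in monoid) nat_pow_eq_of_mod_eq:
  assumes "x \<in> carrier G" "x [^] (m :: nat) = \<one>" "d mod m = e mod m"
  shows "x [^] d = x [^] (e :: nat)"
proof -
  have "x [^] d = x [^] (d mod m)" for d :: nat
  proof -
    have "x [^] d = x [^] (m * (d div m) + d mod m)" by simp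
    also have "\<dots> = (x [^] m) [^] (d div m) \<otimes> x [^] (d mod m)"
      using assms(1) by (simp only: nat_pow_mult nat_pow_pow)
    finally show ?thesis using assms(1,2) by simp
  qed
  then show ?thesis using assms(3) by metis
qed

theorem theorem2p3:
  fixes G :: "'a pair_pre_digraph"
    and A :: "('b, 'm) monoid_scheme"
    and n p k :: nat
  assumes "pair_graph G"
    and "card (pverts G) = n"
    and "comm_group A"
    and "order A = 4 * n"
    and "n = 2 ^ p * (2 * k + 1)"
    and "\<exists>c::int. \<forall>v\<in>pverts G. [int (vertex_degree G v) = c] (mod 2 ^ (p + 1))"
  shows "\<exists>f. distance_magic_labeling A (lex_product G C4) f"
proof -
  interpret G: pair_graph G by fact
  interpret A: comm_group A by fact
  obtain c :: int where c: "\<And>v. v \<in> pverts G \<Longrightarrow> [int (vertex_degree G v) = c] (mod 2 ^ (p + 1))"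
    using assms(6) by blast
  have order: "order A = 2 ^ (p + 2) * (2 * k + 1)" using assms(4,5) by simp
  then have fin: "finite (carrier A)" using A.order_gt_0_iff_finite by simp
  obtain s where s: "s \<in> carrier A" "s [^]\<^bsub>A\<^esub> (2 ^ (p + 2) :: nat) = \<one>\<^bsub>A\<^esub>"
      "\<And>x. x \<in> carrier A \<Longrightarrow> x \<otimes>\<^bsub>A\<^esub> x \<noteq> s"
    using A.nonsquare_of_two_power_order[OF order] by auto
  obtain f where f: "bij_betw f (pverts G \<times> {0..<4::nat}) (carrier A)"
      and opposite: "\<And>x. x \<in> pverts G \<Longrightarrow> f (x, 0) \<otimes>\<^bsub>A\<^esub> f (x, 2) = s"
        "\<And>x. x \<in> pverts G \<Longrightarrow> f (x, 1) \<otimes>\<^bsub>A\<^esub> f (x, 3) = s"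
    using A.labeling_with_constant_opposite_sums[OF s(1,3) G.pair_finite_verts _ fin] assms(2,4)
    by auto
  have mem: "f (x, i) \<in> carrier A" if "x \<in> pverts G" "i < 4" for x i
    using f that by (auto simp: bij_betw_def)
  have verts: "pverts (lex_product G C4) = pverts G \<times> {0..<4}"
    by (simp add: lex_product_def C4_def)
  define r where "r = nat (c mod 2 ^ (p + 1))"
  have weight: "finprod A f (neighborhood (lex_product G C4) (x, i)) = s \<otimes>\<^bsub>A\<^esub> s [^]\<^bsub>A\<^esub> (2 * r)"
    if x: "x \<in> pverts G" and i: "i < 4" for x and i :: nat
  proof -
    let ?N = "neighborhood G x" and ?P = "{(x, (i + 1) mod 4), (x, (i + 3) mod 4)}"
    have N: "?N \<subseteq> pverts G" "finite ?N" "x \<notin> ?N"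
      using G.pair_finite_verts G.pair_no_loops[of "(x, x)"] by (auto simp: neighborhood_def)
    have "i = 0 \<or> i = 1 \<or> i = 2 \<or> i = 3" using i by auto
    then have "?P = {(x, 0), (x, 2)} \<or> ?P = {(x, 1), (x, 3)}"
      by (elim disjE) (simp_all add: doubleton_eq_iff del: One_nat_def)
    moreover have "finprod A f {(x, 0), (x, 2)} = s" "finprod A f {(x, 1), (x, 3)} = s"
      using mem[OF x] opposite[OF x] by simp_all
    ultimately have P: "finprod A f ?P = s" by (elim disjE) (simp_all only:)
    have "finprod A f (?P \<union> ?N \<times> {0..<4})
        = finprod A f ?P \<otimes>\<^bsub>A\<^esub> finprod A f (?N \<times> {0..<4})"
      using N mem x by (intro A.finprod_Un_disjoint) auto
    also have "finprod A f (?N \<times> {0..<4}) = s [^]\<^bsub>A\<^esub> (2 * card ?N)"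
      using N mem opposite s(1) by (intro A.finprod_copies_of_C4) auto
    also have "\<dots> = s [^]\<^bsub>A\<^esub> (2 * r)"
    proof (rule A.nat_pow_eq_of_mod_eq[OF s(1,2)])
      have "int (card ?N mod 2 ^ (p + 1)) = c mod 2 ^ (p + 1)"
        using c[OF x] by (simp add: cong_def vertex_degree_def zmod_int)
      then have "card ?N mod 2 ^ (p + 1) = r" by (metis nat_int r_def)
      then have "2 * (card ?N mod 2 ^ (p + 1)) = 2 * (r mod 2 ^ (p + 1))" by auto
      then show "2 * card ?N mod 2 ^ (p + 2) = 2 * r mod 2 ^ (p + 2)"
        by (simp add: mult_mod_right)
    qed
    finally show ?thesis
      using P neighborhood_lex_product_C4[OF assms(1) x i] by simp
  qed
  have "order A = card (pverts (lex_product G C4))"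
    using assms(2,4) by (simp add: verts card_cartesian_product)
  moreover have "f ` pverts (lex_product G C4) \<subseteq> carrier A" "inj_on f (pverts (lex_product G C4))"
    using f by (auto simp: verts bij_betw_def)
  moreover have "\<exists>\<mu>\<in>carrier A. \<forall>z\<in>pverts (lex_product G C4).
      finprod A f (neighborhood (lex_product G C4) z) = \<mu>"
    using weight s(1) by (intro bexI[of _ "s \<otimes>\<^bsub>A\<^esub> s [^]\<^bsub>A\<^esub> (2 * r)"]) (auto simp: verts)
  ultimately show ?thesis unfolding distance_magic_labeling_def by blast
qed

end
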